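(* For every $k \in \mathbb{N}$, either every tree $T$ of growth at most $k$ satisfies $b(T) \leq \lceil \sqrt{|V(T)|}\rceil$, or there is a tree $T$ of growth at most $k$ with $|V(T)| \leq (4k^2+5k+4)^2$ and $b(T) > \lceil \sqrt{|V(T)|}\rceil$.
   Context: The growth of a connected graph $G$ is the smallest $k$ such that there is a path $P$ in $G$ with every vertex of $G$ within distance $k$ of $P$; a tree of growth at most $k$ is called a $k$-caterpillar. The burning number $b(G)$ is the least $k$ such that there are vertices $v_1,\dots,v_k$ with $\bigcup_{i=1}^{k} N_{k-i}[v_i] = V(G)$, where $N_r[v]$ is the set of vertices at distance at most $r$ from $v$ (equivalently, the number of steps of the burning process: at step 1 a vertex is set on fire, at each later step fire spreads to all neighbours of burning vertices and one new vertex is set on fire). *)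

theory Defs
  imports
    "Graph_Theory.Pair_Digraph"
    "Graph_Theory.Digraph_Component"
    "Graph_Theory.Vertex_Walk"
    "Graph_Theory.Shortest_Path"
begin

text \<open>
  Finite simple graphs are symmetric loop-free digraphs (locale \<^locale>\<open>pair_graph\<close>).
  In this encoding every edge yields the closed walk a, b, a, which
  \<^const>\<open>pre_digraph.cycle\<close> counts as a cycle, so the constant \<^const>\<open>tree\<close>
  excludes all graphs with an edge. A cycle of the undirected graph is one of length at least 3.
\<close>

definition utree :: "'a pair_pre_digraph \<Rightarrow> bool" where
  "utree G \<longleftrightarrow> pair_graph G \<and> connected (with_proj G) \<and>
     \<not> (\<exists>p. pre_digraph.cycle (with_proj G) p \<and> 3 \<le> length p)"

definition gdist :: "'a pair_pre_digraph \<Rightarrow> 'a \<Rightarrow> 'a \<Rightarrow> ereal" where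
  "gdist G u v = wf_digraph.\<mu> (with_proj G) (\<lambda>_. 1) u v"

lemma gdist_le_iff:
  assumes "pair_graph G"
  shows "gdist G u v \<le> ereal (real r) \<longleftrightarrow>
    (\<exists>p. pre_digraph.awalk (with_proj G) u p v \<and> length p \<le> r)"
proof -
  interpret pair_graph G by fact
  have c: "awalk_cost (\<lambda>_. 1) p = real (length p)" for p :: "('a \<times> 'a) list"
    unfolding awalk_cost_def by (induction p) auto
  have m: "gdist G u v = (INF p\<in>{p. awalk u p v}. ereal (real (length p)))"
    unfolding gdist_def \<mu>_def c ..
  show ?thesis
  proof
    assume "gdist G u v \<le> ereal (real r)"
    then have "gdist G u v < ereal (real r + 1)"
      by (rule le_less_trans) simp
    then obtain p where "awalk u p v" "real (length p) < real r + 1"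
      unfolding m by (auto simp: INF_less_iff)
    then show "\<exists>p. awalk u p v \<and> length p \<le> r" by (intro exI[of _ p]) linarith
  next
    assume "\<exists>p. awalk u p v \<and> length p \<le> r"
    then show "gdist G u v \<le> ereal (real r)"
      unfolding m by (auto intro: INF_lower2)
  qed
qed

definition nbhd :: "'a pair_pre_digraph \<Rightarrow> nat \<Rightarrow> 'a \<Rightarrow> 'a set" where
  "nbhd G r v = {u \<in> pverts G. gdist G v u \<le> ereal (real r)}"

text \<open>For a connected finite graph the minimum exists, as every radius that is large enough works.\<close>

definition growth :: "'a pair_pre_digraph \<Rightarrow> nat" where
  "growth G = (LEAST k. \<exists>p. vpath p (with_proj G) \<and>
     (\<forall>v \<in> pverts G. \<exists>u \<in> set p. gdist G u v \<le> ereal (real k)))"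

text \<open>For a finite graph the minimum exists: listing all vertices shows that it is at most
  their number.\<close>

definition burning_number :: "'a pair_pre_digraph \<Rightarrow> nat" where
  "burning_number G = (LEAST k. \<exists>v :: nat \<Rightarrow> 'a. (\<forall>i \<in> {1..k}. v i \<in> pverts G) \<and>
     (\<Union>i \<in> {1..k}. nbhd G (k - i) (v i)) = pverts G)"

end

theory Submission
  imports Defs
begin

text \<open>
  A counterexample with the least number n of vertices has n at most the stated bound. Let m be
  the square root of n, rounded up, and suppose that m is at least 4 k^2 + 5 k + 5. Assign every
  vertex to a nearest vertex of a path that comes within distance k of all vertices. It suffices
  to cover, for some j, an initial piece of the path together with its branches by balls with the
  j largest radii m - 1, ..., m - j such that at least m^2 - (m - j)^2 vertices disappear: the
  rest is a smaller tree of growth at most k on at most (m - j)^2 vertices, so it burns in m - j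
  steps.

  A ball of radius r accounts for 2 r + 1 path vertices, and it loses some only if a branch
  obstructs the position where it ends. Lay balls from left to right, each time with the largest
  radius whose end is unobstructed. A branch of depth d obstructs at most d radii and contributes
  d extra vertices, so skipped radii are paid for by extra vertices. Either at some moment the
  radii used are exactly the largest ones, and the piece is as required, or at least one extra
  vertex is gained per step, and after 2 k^2 + 1 steps these make up for all losses incurred when
  the last skipped radii have to be used at obstructed ends.
\<close>

section \<open>Burning along a path\<close>

text \<open>Of \<open>2 * d\<close> consecutive integers, \<open>d\<close> are even. Ends of balls
  with a common start differ by even amounts, so this bounds the radii that a branch of depth
  \<open>d\<close> obstructs.\<close>

lemma card_even_window:
  fixes y d :: int
  assumes "0 \<le> d"
  shows "finite {r. y \<le> 2 * r \<and> 2 * r \<le> y + 2 * d - 1}"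
    and "int (card {r. y \<le> 2 * r \<and> 2 * r \<le> y + 2 * d - 1}) \<le> d"
proof -
  let ?a = "(y + 1) div 2"
  have sub: "{r. y \<le> 2 * r \<and> 2 * r \<le> y + 2 * d - 1} \<subseteq> {?a..?a + d - 1}"
    by auto
  show "finite {r. y \<le> 2 * r \<and> 2 * r \<le> y + 2 * d - 1}"
    by (rule finite_subset[OF sub]) simp
  have "card {r. y \<le> 2 * r \<and> 2 * r \<le> y + 2 * d - 1} \<le> card {?a..?a + d - 1}"
    by (rule card_mono[OF _ sub]) simp
  then show "int (card {r. y \<le> 2 * r \<and> 2 * r \<le> y + 2 * d - 1}) \<le> d"
    using assms by simp
qed

lemma card_int_interval_le:
  fixes U :: "int set"
  assumes "U \<subseteq> {M - \<mu>..<M}" "0 \<le> \<mu>"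
  shows "int (card U) \<le> \<mu>"
  using card_mono[OF _ assms(1)] assms(2) by simp

lemma full_int_interval:
  fixes U :: "int set"
  assumes "U \<subseteq> {M - \<mu>..<M}" "int (card U) = \<mu>"
  shows "U = {M - \<mu>..<M}"
  by (rule card_subset_eq) (use assms in auto)

text \<open>Spending the \<open>j\<close> largest radii thus lowers the vertex budget from
  \<open>m^2\<close> to \<open>(m - j)^2\<close>.\<close>

lemma sum_odd_int:
  "(\<Sum>r\<in>{int a..<int a + int b}. 2 * r + 1) = (int a + int b)\<^sup>2 - (int a)\<^sup>2"
proof (induction b)
  case (Suc b)
  have "{int a..<int a + int (Suc b)} = insert (int a + int b) {int a..<int a + int b}"
    by auto
  then show ?case
    using Suc by (simp add: power2_eq_square algebra_simps)
qed simp

text \<open>The spine is extended to a ray: d i is the depth of the branch at position i, and 0 beyond the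
  ends. The parameter lam is the distance by which branches near the left end stick out beyond
  it; as i - d i = - lam for such a branch, its own vertices pay for the loss.\<close>

locale spine_burning =
  fixes d :: "int \<Rightarrow> int" and K M lam :: int
  assumes d_nonneg: "0 \<le> d i"
    and d_le: "d i \<le> K"
    and lam: "0 \<le> lam" "lam \<le> K" "0 \<le> i \<Longrightarrow> - lam \<le> i - d i"
    and M_large: "4 * K\<^sup>2 + 5 * K + 5 \<le> M"
begin

text \<open>The bound on the number of balls, chosen so that the excess before the last ball is at
  least \<open>K\<close>.\<close>

definition J :: int where "J = 2 * K\<^sup>2 + 1"

text \<open>The sum starts at \<open>K\<close> because the branches at positions below
  \<open>K\<close> are reserved to pay for \<open>lam\<close>.\<close>

definition depth_sum :: "int \<Rightarrow> int" where "depth_sum z = (\<Sum>i\<in>{K..<z}. d i)"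

definition lengths :: "int set \<Rightarrow> int" where "lengths U = (\<Sum>r\<in>U. 2 * r + 1)"

text \<open>Only radii in {M - J..<M} are used. When the next ball has to reach back to p, every branch
  that can obstruct its end lies at or beyond horizon p, so that no branch is counted in the
  excess for two steps.\<close>

definition horizon :: "int \<Rightarrow> int" where "horizon p = p + 2 * (M - J) + 1 - K"

text \<open>The balance of the covering: positions passed plus branch vertices credited, minus
  lengths spent. Branches between \<open>p\<close> and the horizon are credited in advance, since
  the next ball passes them.\<close>

definition excess :: "int set \<Rightarrow> int \<Rightarrow> int" where
  "excess U p = p + lam + depth_sum (horizon p) - lengths U"

text \<open>Each radius is available once, so centres are indexed by radius. They may lie beyond the
  ends of the spine.\<close>

definition covers :: "int set \<Rightarrow> int \<Rightarrow> (int \<Rightarrow> int) \<Rightarrow> bool" where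
  "covers U q c \<longleftrightarrow> (\<forall>i. 0 \<le> i \<and> i < q \<longrightarrow> (\<exists>r\<in>U. \<bar>i - c r\<bar> + d i \<le> r))"

definition free_cut :: "int \<Rightarrow> bool" where
  "free_cut e \<longleftrightarrow> (\<forall>i<e. i + d i < e) \<and> (\<forall>i\<ge>e. e \<le> i - d i)"

text \<open>An end obstructed for every remaining radius costs 2 K, and the obstructing branches return
  one vertex for each of the a = J - s remaining radii. So the excess can only drop during the
  last 2 K steps, by 2 K - a each. Before that, it is at least the number s of steps, and at
  least mu - 1 when all radii used are among the mu largest, since a skipped radius was
  obstructed.\<close>

definition potential :: "int \<Rightarrow> int \<Rightarrow> int \<Rightarrow> bool" where
  "potential s \<mu> x \<longleftrightarrow>
     (2 * K \<le> J - s \<longrightarrow> s \<le> x \<and> \<mu> - 1 \<le> x) \<and>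
     (J - s \<le> 2 * K \<longrightarrow>
        2 * (J - 2 * K) \<le> 2 * x + (2 * K - (J - s)) * (2 * K - (J - s) - 1))"

text \<open>Positions before \<open>q\<close> are done, but branches from \<open>q\<close> on may
  stick out to the left, so the next ball has to start at \<open>p\<close>. The number \<mu> records
  how far down the list of radii the used ones reach.\<close>

definition partial :: "int set \<Rightarrow> int \<Rightarrow> int \<Rightarrow> (int \<Rightarrow> int) \<Rightarrow> int \<Rightarrow> bool" where
  "partial U p q c \<mu> \<longleftrightarrow> finite U \<and> U \<subseteq> {M - \<mu>..<M} \<and> \<mu> \<le> J \<and> 0 \<le> q \<and> - K \<le> p \<and>
     covers U q c \<and> (\<forall>i\<ge>q. p \<le> i - d i) \<and> potential (int (card U)) \<mu> (excess U p)"

text \<open>The condition \<open>K <= q\<close> keeps the branches that pay for \<open>lam\<close>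
  inside the piece cut off.\<close>

definition solved :: bool where
  "solved \<longleftrightarrow> (\<exists>j q c. 1 \<le> j \<and> j \<le> J \<and> K \<le> q \<and> covers {M - j..<M} q c \<and>
     lengths {M - j..<M} \<le> q + lam + depth_sum q)"

lemma K_nonneg: "0 \<le> K"
  using d_nonneg[of 0] d_le[of 0] by linarith

lemma J_bounds: "1 \<le> J" "2 * J + 5 * K + 3 \<le> M" "J \<le> M"
proof -
  show "1 \<le> J" "2 * J + 5 * K + 3 \<le> M"
    using M_large by (auto simp: J_def)
  then show "J \<le> M" using K_nonneg by linarith
qed

lemma depth_sum_add:
  assumes "K \<le> z" "z \<le> z'"
  shows "depth_sum z' = depth_sum z + (\<Sum>i\<in>{z..<z'}. d i)"
proof -
  have "{K..<z'} = {K..<z} \<union> {z..<z'}" using assms by auto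
  then show ?thesis unfolding depth_sum_def by (simp add: sum.union_disjoint)
qed

lemma depth_sum_mono: "z \<le> z' \<Longrightarrow> depth_sum z \<le> depth_sum z'"
  unfolding depth_sum_def by (rule sum_mono2) (auto intro: d_nonneg)

text \<open>Each obstructed radius is charged to a branch across its end. By parity a branch at
  \<open>i\<close> receives at most \<open>d i\<close> charges, and all these branches lie between
  the two horizons.\<close>

lemma card_blocked_le:
  assumes B: "B \<subseteq> {M - J..<M}" "\<And>r. r \<in> B \<Longrightarrow> \<not> free_cut (p + 2 * r + 1)"
    and p: "- K \<le> p" "p + 2 * (M - J) + 1 - 2 * K \<le> p'"
  shows "depth_sum (horizon p) + int (card B) \<le> depth_sum (horizon p')"
proof -
  define I where "I = {horizon p..<horizon p'}"
  define W where "W i = {r. i - d i - p \<le> 2 * r \<and> 2 * r \<le> (i - d i - p) + 2 * d i - 1}" for i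
  have "B \<subseteq> (\<Union>i\<in>I. W i)"
  proof
    fix r assume "r \<in> B"
    then have r: "M - J \<le> r" "r < M" and "\<not> free_cut (p + 2 * r + 1)" using B by auto
    then obtain i where "(i < p + 2 * r + 1 \<and> p + 2 * r + 1 \<le> i + d i) \<or>
        (p + 2 * r + 1 \<le> i \<and> i - d i < p + 2 * r + 1)"
      unfolding free_cut_def by force
    then have i: "i - d i < p + 2 * r + 1" "p + 2 * r + 1 \<le> i + d i"
      using d_nonneg[of i] by linarith+
    \<comment> \<open>A branch across the end is within \<open>K\<close> of it, hence not before
      \<open>horizon p\<close>. As \<open>M\<close> is large, even the end for the largest radius
      stays clear of \<open>horizon p'\<close>.\<close>
    have "i \<in> I" unfolding I_def horizon_def using i r d_le[of i] p J_bounds K_nonneg by simp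
    moreover have "r \<in> W i" unfolding W_def using i by auto
    ultimately show "r \<in> (\<Union>i\<in>I. W i)" by blast
  qed
  moreover have fin: "finite (\<Union>i\<in>I. W i)"
    unfolding W_def I_def using card_even_window(1)[OF d_nonneg] by blast
  ultimately have "card B \<le> card (\<Union>i\<in>I. W i)" by (rule card_mono[rotated])
  also have "\<dots> \<le> (\<Sum>i\<in>I. card (W i))" by (rule card_UN_le) (simp add: I_def)
  finally have "int (card B) \<le> (\<Sum>i\<in>I. int (card (W i)))" by (metis of_nat_mono of_nat_sum)
  also have "\<dots> \<le> (\<Sum>i\<in>I. d i)"
    unfolding W_def by (intro sum_mono card_even_window(2) d_nonneg)
  finally have "int (card B) \<le> (\<Sum>i\<in>I. d i)" .
  moreover have "depth_sum (horizon p') = depth_sum (horizon p) + (\<Sum>i\<in>I. d i)"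
    unfolding I_def using p J_bounds K_nonneg by (intro depth_sum_add) (auto simp: horizon_def)
  ultimately show ?thesis by simp
qed

text \<open>A ball of radius r centred at p + r reaches exactly from p to p + 2 r.\<close>

lemma covers_insert:
  assumes "covers U q c" "\<forall>i\<ge>q. p \<le> i - d i" "r \<notin> U" "\<And>i. i < q' \<Longrightarrow> i + d i < p + 2 * r + 1"
  shows "covers (insert r U) q' (c(r := p + r))"
  unfolding covers_def
proof (intro allI impI)
  fix i assume i: "0 \<le> i \<and> i < q'"
  show "\<exists>r'\<in>insert r U. \<bar>i - (c(r := p + r)) r'\<bar> + d i \<le> r'"
  proof (cases "i < q")
    case True
    then obtain r' where "r' \<in> U" "\<bar>i - c r'\<bar> + d i \<le> r'"
      using assms(1) i unfolding covers_def by blast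
    then show ?thesis using assms(3) by (intro bexI[of _ r']) auto
  next
    case False
    then have "\<bar>i - (p + r)\<bar> + d i \<le> r"
      using spec[OF assms(2), of i] assms(4)[of i] i by (simp add: not_less abs_le_iff)
    then show ?thesis by simp
  qed
qed

lemma lengths_insert: "finite U \<Longrightarrow> r \<notin> U \<Longrightarrow> lengths (insert r U) = lengths U + 2 * r + 1"
  unfolding lengths_def by simp

section \<open>Laying the balls\<close>

text \<open>The first ball starts at \<open>- lam\<close> to catch the branches sticking out on the
  left; the summand \<open>lam\<close> of the excess cancels this loss.\<close>

lemma partial_initial: "partial {} (- lam) 0 (\<lambda>_. 0) 0"
proof -
  have "0 \<le> excess {} (- lam)"
    unfolding excess_def depth_sum_def lengths_def by (simp add: sum_nonneg d_nonneg)
  \<comment> \<open>So the second clause of \<open>potential\<close> does not apply at the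
    start.\<close>
  moreover have "2 * K < J"
  proof (cases "K = 0")
    case False
    then have "K * 1 \<le> K\<^sup>2"
      unfolding power2_eq_square using K_nonneg by (intro mult_left_mono) auto
    then show ?thesis unfolding J_def by linarith
  qed (use J_bounds in linarith)
  ultimately show ?thesis
    unfolding partial_def potential_def covers_def using lam J_bounds K_nonneg
    by (auto simp: mult.commute)
qed

text \<open>If some remaining radius has a free end, the largest such radius is used, and every
  larger remaining one was obstructed and pays one vertex. Otherwise the largest remaining radius is
  used, and all remaining ones pay.\<close>

lemma partial_step:
  assumes part: "partial U p q c \<mu>" and s: "int (card U) < J - 1"
  shows "solved \<or> (\<exists>U' p' q' c' \<mu>'. partial U' p' q' c' \<mu>' \<and> card U' = Suc (card U))"
proof -
  define s where "s = int (card U)"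
  define x where "x = excess U p"
  define R where "R = {M - J..<M} - U"
  have fin: "finite U" and U: "U \<subseteq> {M - \<mu>..<M}" and mu: "\<mu> \<le> J" and q: "0 \<le> q" and p: "- K \<le> p"
    and cov: "covers U q c" and left: "\<forall>i\<ge>q. p \<le> i - d i" and pot: "potential s \<mu> x"
    using part by (auto simp: partial_def s_def x_def)
  have s_less: "s < J - 1" using assms(2) by (simp add: s_def)
  have UJ: "U \<subseteq> {M - J..<M}" using U mu by auto
  have cardR: "int (card R) = J - s"
    unfolding R_def s_def using UJ fin J_bounds card_mono[OF _ UJ]
    by (subst card_Diff_subset) (auto simp: of_nat_diff)
  have finR: "finite R" unfolding R_def by simp
  show ?thesis
  proof (cases "\<exists>r\<in>R. free_cut (p + 2 * r + 1)")
    case True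
    define F where "F = {r \<in> R. free_cut (p + 2 * r + 1)}"
    define r where "r = Max F"
    define e where "e = p + 2 * r + 1"
    define B where "B = {r' \<in> R. r < r'}"
    define U' where "U' = insert r U"
    \<comment> \<open>This is the number of radii larger than \<open>r\<close>, so \<open>r\<close>
      is among the \<open>\<nu> + 1\<close> largest.\<close>
    define \<nu> where "\<nu> = M - 1 - r"
    define \<mu>' where "\<mu>' = max \<mu> (\<nu> + 1)"
    have finF: "finite F" and "F \<noteq> {}" using True finR by (auto simp: F_def)
    then have "r \<in> F" unfolding r_def by (rule Max_in)
    then have r: "M - J \<le> r" "r < M" "r \<notin> U" and free: "free_cut e"
      by (auto simp: F_def R_def e_def)
    have rmax: "r' \<le> r" if "r' \<in> F" for r' unfolding r_def by (rule Max_ge[OF finF that])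
    have blocked: "\<not> free_cut (p + 2 * r' + 1)" if "r' \<in> B" for r'
      using rmax[of r'] that by (auto simp: B_def F_def)
    have B: "B \<subseteq> {M - J..<M}" by (auto simp: B_def R_def)
    have cov': "covers U' e (c(r := p + r))"
      unfolding U'_def e_def
      by (rule covers_insert[OF cov left r(3)]) (use free in \<open>auto simp: free_cut_def e_def\<close>)
    have len': "lengths U' = lengths U + 2 * r + 1"
      unfolding U'_def by (rule lengths_insert[OF fin r(3)])
    have card': "card U' = Suc (card U)" unfolding U'_def using fin r(3) by simp
    have "depth_sum (horizon p) + int (card B) \<le> depth_sum (horizon e)"
      by (rule card_blocked_le[OF B blocked p]) (use r K_nonneg in \<open>auto simp: e_def\<close>)
    then have gain: "x + int (card B) \<le> excess U' e"
      unfolding x_def excess_def len' e_def by simp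
    have U'_sub: "U' \<subseteq> {M - \<mu>'..<M}"
      using order.trans[OF U, of "{M - \<mu>'..<M}"] r by (auto simp: U'_def \<mu>'_def \<nu>_def)
    have mu': "\<mu>' \<le> J" using mu r by (auto simp: \<mu>'_def \<nu>_def)
    have e_ge: "K \<le> e" "horizon p \<le> e"
      using r p J_bounds K_nonneg by (auto simp: e_def horizon_def)
    have mu_ge: "s \<le> \<mu>" if "0 \<le> \<mu>"
      unfolding s_def by (rule card_int_interval_le[OF U that])
    have mu_nonneg: "0 \<le> \<mu>" if "0 < s"
    proof -
      from that obtain r0 where "r0 \<in> U" by (auto simp: s_def card_gt_0_iff)
      then show ?thesis using U by auto
    qed
    \<comment> \<open>With \<open>s + 1\<close> radii among the \<mu>' largest there is no gap. As
      \<open>e\<close> is a free cut, the new ball covers its full length, and \<open>0 <= x\<close>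
      suffices.\<close>
    have finish: solved if "s + 1 = \<mu>'" "0 \<le> x"
    proof -
      have full: "U' = {M - \<mu>'..<M}"
        by (rule full_int_interval[OF U'_sub]) (use that card' in \<open>simp add: s_def\<close>)
      have "lengths {M - \<mu>'..<M} \<le> e + lam + depth_sum e"
        using that(2) depth_sum_mono[OF e_ge(2)] unfolding full[symmetric] len' x_def excess_def e_def
        by simp
      then show ?thesis
        unfolding solved_def using cov' full mu' e_ge that(1)
        by (intro exI[of _ \<mu>'] exI[of _ e] exI[of _ "c(r := p + r)"]) (simp add: s_def)
    qed
    have step: ?thesis if "potential (s + 1) \<mu>' (excess U' e)"
    proof -
      have "partial U' e e (c(r := p + r)) \<mu>'"
        unfolding partial_def using fin U'_sub mu' e_ge K_nonneg cov' free that card'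
        by (auto simp: U'_def free_cut_def s_def algebra_simps)
      then show ?thesis using card' by blast
    qed
    show ?thesis
    proof (cases "2 * K \<le> J - (s + 1)")
      case phase1: True
      then have x: "s \<le> x" "\<mu> - 1 \<le> x" using pot by (auto simp: potential_def)
      have s0: "0 \<le> s" by (simp add: s_def)
      have done_or: "solved \<or> (s + 1 \<le> x + int (card B) \<and> \<mu>' - 1 \<le> x + int (card B))"
      proof (cases "\<nu> < \<mu>")
        \<comment> \<open>Here \<mu>' is \<mu>. Either the gaps are now filled, or
          \<open>s + 1 <= \<mu> - 1\<close>, which is at most \<open>x\<close>.\<close>
        case True
        then have "\<mu>' = \<mu>" by (simp add: \<mu>'_def)
        moreover have "s + 1 \<le> \<mu>'"
          using card_int_interval_le[OF U'_sub] card' True r by (simp add: \<mu>'_def s_def \<nu>_def)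
        ultimately show ?thesis using finish x s0 by (cases "s + 1 = \<mu>'") auto
      next
        case False
        then have mu'_eq: "\<mu>' = \<nu> + 1" by (simp add: \<mu>'_def)
        \<comment> \<open>Every radius above \<open>r\<close> is used or obstructed. If none is
          skipped, the radii used have no gap; otherwise the skipped ones lift the excess.\<close>
        have UB: "{M - \<nu>..<M} \<subseteq> U \<union> B"
          using r by (auto simp: B_def R_def \<nu>_def)
        have "card {M - \<nu>..<M} \<le> card U + card B"
          using card_mono[OF _ UB] card_Un_le[of U B] fin finR by (simp add: B_def)
        then have "\<nu> \<le> s + int (card B)" using r by (simp add: s_def \<nu>_def)
        moreover have "s \<le> \<nu>"
          unfolding s_def
        proof (rule card_int_interval_le)
          show "U \<subseteq> {M - \<nu>..<M}" using order.trans[OF U, of "{M - \<nu>..<M}"] False by auto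
          show "0 \<le> \<nu>" using r by (simp add: \<nu>_def)
        qed
        ultimately show ?thesis using finish x s0 mu'_eq by (cases "s = \<nu>") auto
      qed
      then show ?thesis
      proof
        assume "s + 1 \<le> x + int (card B) \<and> \<mu>' - 1 \<le> x + int (card B)"
        then have "s + 1 \<le> excess U' e" "\<mu>' - 1 \<le> excess U' e" using gain by linarith+
        then show ?thesis using phase1 by (intro step) (auto simp: potential_def)
      qed simp
    next
      case False
      define u where "u = 2 * K - (J - s)"
      have u: "0 \<le> u" using False by (simp add: u_def)
      have "2 * (J - 2 * K) \<le> 2 * x + u * (u - 1)"
        using pot False by (auto simp: potential_def u_def)
      \<comment> \<open>The potential would tolerate a drop by \<open>u\<close> here, but a free end
        causes none.\<close>
      moreover have "u * (u - 1) \<le> (u + 1) * u" using u by (simp add: algebra_simps)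
      ultimately have "2 * (J - 2 * K) \<le> 2 * excess U' e + (u + 1) * u" using gain by linarith
      then show ?thesis using False
        by (intro step) (auto simp: potential_def u_def algebra_simps)
    qed
  next
    case False
    define r where "r = Max R"
    define e where "e = p + 2 * r + 1"
    define U' where "U' = insert r U"
    define \<nu> where "\<nu> = M - 1 - r"
    define \<mu>' where "\<mu>' = max \<mu> (\<nu> + 1)"
    have "R \<noteq> {}" using cardR s_less by auto
    then have "r \<in> R" unfolding r_def using finR by simp
    then have r: "M - J \<le> r" "r < M" "r \<notin> U" by (auto simp: R_def)
    have rmax: "r' \<le> r" if "r' \<in> R" for r' unfolding r_def by (rule Max_ge[OF finR that])
    have R: "R \<subseteq> {M - J..<M}" by (auto simp: R_def)
    \<comment> \<open>Branches before \<open>e - K\<close> end before \<open>e\<close>, and those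
      from \<open>e - K\<close> on reach back at most to \<open>e - 2 * K\<close>, the next
      start.\<close>
    have cov': "covers U' (e - K) (c(r := p + r))"
      unfolding U'_def
    proof (rule covers_insert[OF cov left r(3)])
      fix i assume "i < e - K"
      then show "i + d i < p + 2 * r + 1" using d_le[of i] by (simp add: e_def)
    qed
    have len': "lengths U' = lengths U + 2 * r + 1"
      unfolding U'_def by (rule lengths_insert[OF fin r(3)])
    have card': "card U' = Suc (card U)" unfolding U'_def using fin r(3) by simp
    have "depth_sum (horizon p) + int (card R) \<le> depth_sum (horizon (e - 2 * K))"
      by (rule card_blocked_le[OF R _ p]) (use r K_nonneg False in \<open>auto simp: e_def\<close>)
    then have gain: "x + (J - s) - 2 * K \<le> excess U' (e - 2 * K)"
      unfolding x_def excess_def len' e_def cardR by simp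
    have U'_sub: "U' \<subseteq> {M - \<mu>'..<M}"
      using order.trans[OF U, of "{M - \<mu>'..<M}"] r by (auto simp: U'_def \<mu>'_def \<nu>_def)
    have mu': "\<mu>' \<le> J" using mu r by (auto simp: \<mu>'_def \<nu>_def)
    have e_ge: "0 \<le> e - K" "- K \<le> e - 2 * K"
      using r p J_bounds K_nonneg by (auto simp: e_def)
    have left': "\<forall>i\<ge>e - K. e - 2 * K \<le> i - d i"
    proof (intro allI impI)
      fix i assume "e - K \<le> i"
      then show "e - 2 * K \<le> i - d i" using d_le[of i] by linarith
    qed
    have step: ?thesis if "potential (s + 1) \<mu>' (excess U' (e - 2 * K))"
    proof -
      have "partial U' (e - 2 * K) (e - K) (c(r := p + r)) \<mu>'"
        unfolding partial_def using fin U'_sub mu' e_ge K_nonneg cov' left' that card'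
        by (auto simp: U'_def s_def algebra_simps)
      then show ?thesis using card' by blast
    qed
    show ?thesis
    proof (cases "2 * K \<le> J - (s + 1)")
      case phase1: True
      then have x: "s \<le> x" "\<mu> - 1 \<le> x" using pot by (auto simp: potential_def)
      have "\<mu>' - 1 \<le> x"
      proof (cases "\<nu> < \<mu>")
        case False
        \<comment> \<open>No radius above the largest remaining one is left, so
          \<open>\<nu> <= s\<close>, and \<open>s <= x\<close> suffices.\<close>
        have "{M - \<nu>..<M} \<subseteq> U"
        proof
          fix r' assume "r' \<in> {M - \<nu>..<M}"
          then show "r' \<in> U" using rmax[of r'] r by (auto simp: R_def \<nu>_def)
        qed
        then have "card {M - \<nu>..<M} \<le> card U" by (rule card_mono[OF fin])
        then have "\<nu> \<le> s" using r by (simp add: s_def \<nu>_def)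
        then show ?thesis using x False by (simp add: \<mu>'_def)
      qed (use x in \<open>simp add: \<mu>'_def\<close>)
      then have "s + 1 \<le> excess U' (e - 2 * K)" "\<mu>' - 1 \<le> excess U' (e - 2 * K)"
        using gain x phase1 by linarith+
      then show ?thesis using phase1 by (intro step) (auto simp: potential_def J_def)
    next
      case False
      define u where "u = 2 * K - (J - s)"
      have "2 * (J - 2 * K) \<le> 2 * x + u * (u - 1)"
        using pot False by (auto simp: potential_def u_def)
      \<comment> \<open>The drop by at most \<open>u\<close> is exactly what the triangular number
        in \<open>potential\<close> allows.\<close>
      moreover have "u * (u - 1) + 2 * u = (u + 1) * u" by (simp add: algebra_simps)
      moreover have "x - u \<le> excess U' (e - 2 * K)" using gain by (simp add: u_def)
      ultimately have "2 * (J - 2 * K) \<le> 2 * excess U' (e - 2 * K) + (u + 1) * u" by linarith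
      then show ?thesis using False
        by (intro step) (auto simp: potential_def u_def algebra_simps)
    qed
  qed
qed

text \<open>The one radius left completes the \<open>J\<close> largest. No ball follows, so cutting
  back to \<open>q'\<close> costs only \<open>K\<close>, which the excess pays.\<close>

lemma partial_final:
  assumes part: "partial U p q c \<mu>" and s: "int (card U) = J - 1"
  shows solved
proof -
  have fin: "finite U" and U: "U \<subseteq> {M - \<mu>..<M}" and mu: "\<mu> \<le> J" and p: "- K \<le> p"
    and cov: "covers U q c" and left: "\<forall>i\<ge>q. p \<le> i - d i"
    and pot: "potential (J - 1) \<mu> (excess U p)"
    using part s by (auto simp: partial_def)
  have UJ: "U \<subseteq> {M - J..<M}" using U mu by auto
  have "\<exists>r. r \<in> {M - J..<M} - U"
  proof (rule ccontr)
    assume "\<nexists>r. r \<in> {M - J..<M} - U"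
    then have "U = {M - J..<M}" using UJ by auto
    then show False using s J_bounds by simp
  qed
  then obtain r where r: "M - J \<le> r" "r < M" "r \<notin> U" by auto
  define q' where "q' = p + 2 * r + 1 - K"
  have full: "insert r U = {M - J..<M}"
    by (rule full_int_interval) (use UJ r fin s in auto)
  have cov': "covers {M - J..<M} q' (c(r := p + r))"
    unfolding full[symmetric]
  proof (rule covers_insert[OF cov left r(3)])
    fix i assume "i < q'"
    then show "i + d i < p + 2 * r + 1" using d_le[of i] by (simp add: q'_def)
  qed
  have "K \<le> excess U p"
  proof (cases "K = 0")
    case True
    then have "J - 1 \<le> excess U p" using pot unfolding potential_def by force
    then show ?thesis using True J_bounds(1) by linarith
  next
    case False
    then have "2 * (J - 2 * K) \<le> 2 * excess U p + (2 * K - 1) * (2 * K - 2)"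
      using pot K_nonneg by (simp add: potential_def)
    \<comment> \<open>The value of \<open>J\<close> makes this inequality reduce exactly to
      \<open>K <= excess U p\<close>.\<close>
    then show ?thesis by (simp add: J_def power2_eq_square algebra_simps)
  qed
  moreover have "depth_sum (horizon p) \<le> depth_sum q'"
    using r by (intro depth_sum_mono) (simp add: horizon_def q'_def)
  ultimately have "lengths {M - J..<M} \<le> q' + lam + depth_sum q'"
    unfolding full[symmetric] lengths_insert[OF fin r(3)] excess_def q'_def by simp
  moreover have "K \<le> q'" using r p J_bounds K_nonneg by (simp add: q'_def)
  ultimately show ?thesis
    unfolding solved_def using cov' J_bounds
    by (intro exI[of _ J] exI[of _ q'] exI[of _ "c(r := p + r)"]) simp
qed

lemma solved_holds: solved
proof (rule ccontr)
  assume unsolved: "\<not> solved"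
  have "\<exists>U p q c \<mu>. partial U p q c \<mu> \<and> card U = n" if "int n \<le> J - 1" for n
    using that
  proof (induction n)
    case 0
    then show ?case using partial_initial by force
  next
    case (Suc n)
    then obtain U p q c \<mu> where "partial U p q c \<mu>" "card U = n" by auto
    then show ?case using partial_step[of U p q c \<mu>] unsolved Suc.prems by auto
  qed
  from this[of "nat (J - 1)"] obtain U p q c \<mu> where "partial U p q c \<mu>" "int (card U) = J - 1"
    using J_bounds by auto
  then show False using partial_final unsolved by blast
qed

end

section \<open>Walks, trees and isomorphic copies\<close>

lemma pcas_relpow:
  "(\<exists>p. length p = n \<and> set p \<subseteq> E \<and> pcas u p v) \<longleftrightarrow> (u, v) \<in> E ^^ n"
proof (induction n arbitrary: u)
  case (Suc n)
  have "(\<exists>p. length p = Suc n \<and> set p \<subseteq> E \<and> pcas u p v) \<longleftrightarrow>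
      (\<exists>w. (u, w) \<in> E \<and> (\<exists>p. length p = n \<and> set p \<subseteq> E \<and> pcas w p v))"
  proof
    assume "\<exists>p. length p = Suc n \<and> set p \<subseteq> E \<and> pcas u p v"
    then obtain e p where "length (e # p) = Suc n" "set (e # p) \<subseteq> E" "pcas u (e # p) v"
      by (metis length_Suc_conv)
    then show "\<exists>w. (u, w) \<in> E \<and> (\<exists>p. length p = n \<and> set p \<subseteq> E \<and> pcas w p v)"
      by (intro exI[of _ "snd e"]) (cases e, auto)
  next
    assume "\<exists>w. (u, w) \<in> E \<and> (\<exists>p. length p = n \<and> set p \<subseteq> E \<and> pcas w p v)"
    then obtain w p where "(u, w) \<in> E" "length p = n" "set p \<subseteq> E" "pcas w p v" by blast
    then show "\<exists>p. length p = Suc n \<and> set p \<subseteq> E \<and> pcas u p v"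
      by (intro exI[of _ "(u, w) # p"]) auto
  qed
  also have "\<dots> \<longleftrightarrow> (u, v) \<in> E ^^ Suc n"
    unfolding Suc.IH relpow_commute[symmetric] relpow.simps(2) by auto
  finally show ?case .
qed simp

lemma gdist_le_relpow:
  assumes "pair_graph G"
  shows "gdist G u v \<le> ereal (real r) \<longleftrightarrow> u \<in> pverts G \<and> (\<exists>n\<le>r. (u, v) \<in> parcs G ^^ n)"
  unfolding gdist_le_iff[OF assms] pre_digraph.awalk_def cas_with_proj_eq with_proj_simps
    pcas_relpow[symmetric]
  by blast

lemma relpow_map:
  assumes "(u, v) \<in> E ^^ n" "\<And>a b. (a, b) \<in> E \<Longrightarrow> (h a, h b) \<in> E'"
  shows "(h u, h v) \<in> E' ^^ n"
  using assms(1) by (induction n arbitrary: v) (auto intro: assms(2))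

lemma relpow_sym:
  assumes "sym E" "(u, v) \<in> E ^^ n"
  shows "(v, u) \<in> E ^^ n"
  using assms(2)
proof (induction n arbitrary: v)
  case (Suc n)
  then obtain w where "(u, w) \<in> E ^^ n" "(w, v) \<in> E" by auto
  then show ?case using Suc.IH assms(1) by (meson relpow_Suc_I2 symD)
qed simp

lemma pair_graph_iff:
  "pair_graph G \<longleftrightarrow> finite (pverts G) \<and> parcs G \<subseteq> pverts G \<times> pverts G \<and> sym (parcs G) \<and>
     irrefl (parcs G)"
proof
  assume "pair_graph G"
  then interpret pair_graph G .
  show "finite (pverts G) \<and> parcs G \<subseteq> pverts G \<times> pverts G \<and> sym (parcs G) \<and> irrefl (parcs G)"
    using pair_finite_verts pair_sym_arcs
    by (auto simp: symmetric_def irrefl_def dest: in_arcsD1 in_arcsD2 pair_no_loops)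
next
  assume G: "finite (pverts G) \<and> parcs G \<subseteq> pverts G \<times> pverts G \<and> sym (parcs G) \<and>
    irrefl (parcs G)"
  then have "finite (parcs G)" by (meson finite_SigmaI finite_subset)
  then show "pair_graph G"
    using G by unfold_locales (auto simp: symmetric_def irrefl_def)
qed

definition long_cycle :: "'a pair_pre_digraph \<Rightarrow> 'a \<Rightarrow> ('a \<times> 'a) list \<Rightarrow> bool" where
  "long_cycle G u p \<longleftrightarrow> u \<in> pverts G \<and> set p \<subseteq> parcs G \<and> pcas u p u \<and>
     distinct (tl (pawalk_verts u p)) \<and> 3 \<le> length p"

lemma utree_iff:
  "utree G \<longleftrightarrow> pair_graph G \<and> pverts G \<noteq> {} \<and>
     (\<forall>u\<in>pverts G. \<forall>v\<in>pverts G. (u, v) \<in> (parcs G)\<^sup>*) \<and> (\<nexists>u p. long_cycle G u p)"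
proof (cases "pair_graph G")
  case True
  then interpret pair_graph G .
  \<comment> \<open>Connectedness is defined through the symmetric closure, which adds no arcs
    here.\<close>
  have mk: "parcs (mk_symmetric (with_proj G)) = parcs G"
    using adj_mk_symmetric_eq[OF pair_sym_arcs] by simp
  interpret S: pair_wf_digraph "mk_symmetric (with_proj G)" ..
  have "connected (with_proj G) \<longleftrightarrow> pverts G \<noteq> {} \<and>
      (\<forall>u\<in>pverts G. \<forall>v\<in>pverts G. (u, v) \<in> (parcs G)\<^sup>*)"
    unfolding connected_def strongly_connected_def S.reachable_conv mk with_proj_simps
    by (auto simp: mk_symmetric_def)
  moreover have "(\<exists>p. pre_digraph.cycle (with_proj G) p \<and> 3 \<le> length p) \<longleftrightarrow> (\<exists>u p. long_cycle G u p)"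
    unfolding pre_digraph.cycle_def pre_digraph.awalk_def cas_with_proj_eq
      awalk_verts_with_proj_eq with_proj_simps long_cycle_def
    by (metis list.size(3) not_numeral_le_zero)
  ultimately show ?thesis unfolding utree_def using True by blast
qed (simp add: utree_def)

lemma pawalk_verts_map:
  "pawalk_verts (h u) (map (map_prod h h) p) = map h (pawalk_verts u p)"
  by (induction p arbitrary: u) auto

lemma pcas_map: "pcas u p v \<Longrightarrow> pcas (h u) (map (map_prod h h) p) (h v)"
  by (induction p arbitrary: u) auto

lemma pawalk_verts_subset:
  "u \<in> V \<Longrightarrow> set p \<subseteq> V \<times> V \<Longrightarrow> set (pawalk_verts u p) \<subseteq> V"
  by (induction p arbitrary: u) force+

text \<open>Serves both to pull cycles back along an isomorphism and, with the identity, to pass to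
  subgraphs.\<close>

lemma long_cycle_map:
  assumes "long_cycle H u p" "inj_on h (pverts H)" "h ` pverts H \<subseteq> pverts G"
    and "\<And>a b. (a, b) \<in> parcs H \<Longrightarrow> (h a, h b) \<in> parcs G" "parcs H \<subseteq> pverts H \<times> pverts H"
  shows "long_cycle G (h u) (map (map_prod h h) p)"
proof -
  have "set (tl (pawalk_verts u p)) \<subseteq> pverts H"
    using pawalk_verts_subset[of u "pverts H" p] assms(1,5) list.set_sel(2)[of "pawalk_verts u p"]
    unfolding long_cycle_def by (cases "pawalk_verts u p") auto
  then have "distinct (map h (tl (pawalk_verts u p)))"
    using assms(1,2) by (auto simp: long_cycle_def distinct_map intro: inj_on_subset)
  then show ?thesis
    using assms(1,3,4) unfolding long_cycle_def pawalk_verts_map map_tl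
    by (auto intro!: pcas_map)
qed

section \<open>Spines and burning sequences\<close>

lemma vwalk_arcs_subset_iff:
  "set (vwalk_arcs p) \<subseteq> E \<longleftrightarrow> (\<forall>i. Suc i < length p \<longrightarrow> (p ! i, p ! Suc i) \<in> E)"
  by (induction p rule: vwalk_arcs.induct) (auto simp: less_Suc_eq_0_disj)

lemma vpath_iff:
  "vpath p (with_proj G) \<longleftrightarrow> p \<noteq> [] \<and> distinct p \<and> set p \<subseteq> pverts G \<and>
     (\<forall>i. Suc i < length p \<longrightarrow> (p ! i, p ! Suc i) \<in> parcs G)"
  unfolding vpath_def vwalk_def with_proj_simps vwalk_arcs_subset_iff by auto

definition spine :: "'a pair_pre_digraph \<Rightarrow> nat \<Rightarrow> 'a list \<Rightarrow> bool" where
  "spine G k p \<longleftrightarrow> p \<noteq> [] \<and> distinct p \<and> set p \<subseteq> pverts G \<and>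
     (\<forall>i. Suc i < length p \<longrightarrow> (p ! i, p ! Suc i) \<in> parcs G) \<and>
     (\<forall>v\<in>pverts G. \<exists>u\<in>set p. \<exists>n\<le>k. (u, v) \<in> parcs G ^^ n)"

lemma spine_iff:
  assumes "pair_graph G"
  shows "spine G k p \<longleftrightarrow> vpath p (with_proj G) \<and>
     (\<forall>v \<in> pverts G. \<exists>u \<in> set p. gdist G u v \<le> ereal (real k))"
  unfolding spine_def vpath_iff gdist_le_relpow[OF assms] by blast

lemma growth_le: "pair_graph G \<Longrightarrow> spine G k p \<Longrightarrow> growth G \<le> k"
  unfolding growth_def spine_iff by (rule Least_le) blast

lemma growth_spine:
  assumes "utree G" "growth G \<le> k"
  shows "\<exists>p. spine G k p"
proof -
  have G: "pair_graph G" "pverts G \<noteq> {}" "finite (pverts G)"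
    and conn: "\<And>u v. u \<in> pverts G \<Longrightarrow> v \<in> pverts G \<Longrightarrow> (u, v) \<in> (parcs G)\<^sup>*"
    using assms(1) by (auto simp: utree_iff pair_graph_iff)
  then obtain a where a: "a \<in> pverts G" by blast
  have "\<forall>v\<in>pverts G. \<exists>n. (a, v) \<in> parcs G ^^ n"
    using conn[OF a] by (auto simp: rtrancl_power)
  then obtain f where f: "(a, v) \<in> parcs G ^^ f v" if "v \<in> pverts G" for v by metis
  \<comment> \<open>A one-vertex path with a large radius shows that the minimum defining
    \<open>growth\<close> exists.\<close>
  have "spine G (Max (f ` pverts G)) [a]"
    unfolding spine_def using a f G(3) by (auto intro!: exI[of _ "f _"])
  then have "\<exists>k. \<exists>p. spine G k p" by blast
  then have "\<exists>p. spine G (LEAST k. \<exists>p. spine G k p) p" by (rule LeastI_ex)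
  then have "\<exists>p. spine G (growth G) p" unfolding growth_def spine_iff[OF G(1)] .
  then show ?thesis using assms(2) unfolding spine_def by (meson order.trans)
qed

definition burning_seq :: "'a pair_pre_digraph \<Rightarrow> nat \<Rightarrow> (nat \<Rightarrow> 'a) \<Rightarrow> bool" where
  "burning_seq G b v \<longleftrightarrow> (\<forall>i \<in> {1..b}. v i \<in> pverts G) \<and>
     (\<forall>u\<in>pverts G. \<exists>i\<in>{1..b}. \<exists>n\<le>b - i. (v i, u) \<in> parcs G ^^ n)"

lemma burning_seq_iff:
  assumes "pair_graph G"
  shows "burning_seq G b v \<longleftrightarrow> (\<forall>i \<in> {1..b}. v i \<in> pverts G) \<and>
     (\<Union>i \<in> {1..b}. nbhd G (b - i) (v i)) = pverts G"
  unfolding burning_seq_def nbhd_def gdist_le_relpow[OF assms] by blast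

lemma burning_number_le: "pair_graph G \<Longrightarrow> burning_seq G b v \<Longrightarrow> burning_number G \<le> b"
  unfolding burning_number_def burning_seq_iff by (rule Least_le) blast

lemma burning_number_seq:
  assumes "pair_graph G"
  shows "\<exists>v. burning_seq G (burning_number G) v"
proof -
  have "finite (pverts G)" using assms by (simp add: pair_graph_iff)
  then obtain f where "bij_betw f {1..card (pverts G)} (pverts G)"
    using ex_bij_betw_nat_finite_1 by blast
  then have f: "pverts G = f ` {1..card (pverts G)}" by (simp add: bij_betw_def)
  have "burning_seq G (card (pverts G)) f"
    unfolding burning_seq_def
  proof (intro conjI ballI)
    fix u assume "u \<in> pverts G"
    then obtain i where "i \<in> {1..card (pverts G)}" "u = f i" using f by blast
    then show "\<exists>i\<in>{1..card (pverts G)}. \<exists>n\<le>card (pverts G) - i. (f i, u) \<in> parcs G ^^ n"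
      by (intro bexI[of _ i] exI[of _ 0]) auto
  qed (use f in blast)
  then have "\<exists>b. \<exists>v. burning_seq G b v" by blast
  then have "\<exists>v. burning_seq G (LEAST b. \<exists>v. burning_seq G b v) v" by (rule LeastI_ex)
  then show ?thesis unfolding burning_number_def burning_seq_iff[OF assms] .
qed

text \<open>Counterexamples are sought on natural numbers, while the tree may have any vertex type.
  An injection carries the spine over, and its inverse carries burning sequences back.\<close>

lemma utree_nat_copy:
  fixes G :: "'a pair_pre_digraph"
  assumes G: "utree G" and growth: "growth G \<le> k"
  shows "\<exists>H :: nat pair_pre_digraph. utree H \<and> growth H \<le> k \<and> card (pverts H) = card (pverts G) \<and>
    burning_number G \<le> burning_number H"
proof -
  have pg: "pair_graph G" and fin: "finite (pverts G)" and ne: "pverts G \<noteq> {}"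
    and arcs: "parcs G \<subseteq> pverts G \<times> pverts G"
    and conn: "\<And>u v. u \<in> pverts G \<Longrightarrow> v \<in> pverts G \<Longrightarrow> (u, v) \<in> (parcs G)\<^sup>*"
    and acyc: "\<And>u p. \<not> long_cycle G u p"
    using G by (auto simp: utree_iff pair_graph_iff)
  obtain f :: "'a \<Rightarrow> nat" where inj: "inj_on f (pverts G)"
    using finite_imp_inj_to_nat_seg[OF fin] by blast
  define g where "g = inv_into (pverts G) f"
  define H where "H = \<lparr>pverts = f ` pverts G, parcs = map_prod f f ` parcs G\<rparr>"
  have gf: "g (f a) = a" if "a \<in> pverts G" for a
    unfolding g_def by (rule inv_into_f_f[OF inj that])
  have fE: "(f a, f b) \<in> parcs H" if "(a, b) \<in> parcs G" for a b
    using that by (force simp: H_def)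
  have gE: "(g x, g y) \<in> parcs G" if "(x, y) \<in> parcs H" for x y
    using that arcs by (auto simp: H_def gf)
  have pgH: "pair_graph H"
    using pg inj by (fastforce simp: pair_graph_iff H_def sym_def irrefl_def dest: inj_onD)
  have acycH: "\<not> long_cycle H u p" for u p
  proof
    assume "long_cycle H u p"
    then have "long_cycle G (g u) (map (map_prod g g) p)"
      by (rule long_cycle_map) (use gE arcs in \<open>auto simp: H_def gf intro!: inj_onI\<close>)
    then show False using acyc by blast
  qed
  have connH: "(x, y) \<in> (parcs H)\<^sup>*" if xy: "x \<in> pverts H" "y \<in> pverts H" for x y
  proof -
    obtain a b where "x = f a" "y = f b" "a \<in> pverts G" "b \<in> pverts G"
      using xy by (auto simp: H_def)
    then show ?thesis
      using conn[of a b] relpow_map[of a b _ "parcs G" f "parcs H"] fE by (auto simp: rtrancl_power)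
  qed
  have "utree H" unfolding utree_iff using pgH ne connH acycH by (auto simp: H_def)
  moreover obtain p where p: "spine G k p" using growth_spine[OF G growth] by blast
  have "spine H k (map f p)"
    unfolding spine_def
  proof (intro conjI allI impI ballI)
    show "distinct (map f p)"
      using p inj by (auto simp: spine_def distinct_map intro: inj_on_subset)
    fix y assume "y \<in> pverts H"
    then obtain b where "y = f b" "b \<in> pverts G" by (auto simp: H_def)
    moreover from this obtain a n where "a \<in> set p" "n \<le> k" "(a, b) \<in> parcs G ^^ n"
      using p unfolding spine_def by blast
    ultimately show "\<exists>u\<in>set (map f p). \<exists>n\<le>k. (u, y) \<in> parcs H ^^ n"
      using relpow_map[of a b n "parcs G" f "parcs H"] fE by auto
  qed (use p fE in \<open>auto simp: spine_def H_def\<close>)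
  then have "growth H \<le> k" by (rule growth_le[OF pgH])
  moreover have "card (pverts H) = card (pverts G)"
    unfolding H_def using inj by (simp add: card_image)
  moreover obtain v where v: "burning_seq H (burning_number H) v"
    using burning_number_seq[OF pgH] by blast
  have "burning_seq G (burning_number H) (\<lambda>i. g (v i))"
    unfolding burning_seq_def
  proof (intro conjI ballI)
    fix i assume "i \<in> {1..burning_number H}"
    then have "v i \<in> pverts H" using v by (simp add: burning_seq_def)
    then show "g (v i) \<in> pverts G" by (auto simp: H_def gf)
  next
    fix u assume u: "u \<in> pverts G"
    then have "f u \<in> pverts H" by (simp add: H_def)
    then obtain i n where "i \<in> {1..burning_number H}" "n \<le> burning_number H - i"
        "(v i, f u) \<in> parcs H ^^ n"
      using v unfolding burning_seq_def by blast
    moreover from this have "(g (v i), g (f u)) \<in> parcs G ^^ n"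
      using relpow_map[of "v i" "f u" n "parcs H" g "parcs G"] gE by blast
    ultimately show "\<exists>i\<in>{1..burning_number H}. \<exists>n\<le>burning_number H - i. (g (v i), u) \<in> parcs G ^^ n"
      using gf[OF u] by auto
  qed
  then have "burning_number G \<le> burning_number H" by (rule burning_number_le[OF pg])
  ultimately show ?thesis by blast
qed

section \<open>Branches along a spine\<close>

locale spined_graph =
  fixes G :: "'a pair_pre_digraph" and k :: nat and p :: "'a list"
  assumes tree: "utree G" and spine: "spine G k p"
begin

section \<open>Levels, feet and branches\<close>

definition level :: "'a \<Rightarrow> nat" where
  "level u = (LEAST n. \<exists>i<length p. (p ! i, u) \<in> parcs G ^^ n)"

text \<open>Ties between nearest spine vertices go to the smallest index; this is what makes the
  branches connected.\<close>

definition foot :: "'a \<Rightarrow> nat" where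
  "foot u = (LEAST i. i < length p \<and> (p ! i, u) \<in> parcs G ^^ level u)"

definition branch :: "nat \<Rightarrow> 'a set" where
  "branch i = {u \<in> pverts G. foot u = i}"

definition depth :: "nat \<Rightarrow> nat" where
  "depth i = Max (level ` branch i)"

lemma pg: "pair_graph G" and fin: "finite (pverts G)" and arcs: "parcs G \<subseteq> pverts G \<times> pverts G"
  and sym: "sym (parcs G)"
  using tree by (auto simp: utree_iff pair_graph_iff)

lemma p_nth: "i < length p \<Longrightarrow> p ! i \<in> pverts G"
  using spine by (auto simp: spine_def)

lemma level_le: "i < length p \<Longrightarrow> (p ! i, u) \<in> parcs G ^^ n \<Longrightarrow> level u \<le> n"
  unfolding level_def by (rule Least_le) blast

lemma foot_le: "i < length p \<Longrightarrow> (p ! i, u) \<in> parcs G ^^ level u \<Longrightarrow> foot u \<le> i"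
  unfolding foot_def by (rule Least_le) blast

lemma foot:
  assumes "u \<in> pverts G"
  shows "foot u < length p" "(p ! foot u, u) \<in> parcs G ^^ level u" "level u \<le> k"
proof -
  obtain i n where i: "i < length p" "n \<le> k" "(p ! i, u) \<in> parcs G ^^ n"
    using spine assms unfolding spine_def by (metis in_set_conv_nth)
  then have "\<exists>n. \<exists>i<length p. (p ! i, u) \<in> parcs G ^^ n" by blast
  then have "\<exists>i<length p. (p ! i, u) \<in> parcs G ^^ level u" unfolding level_def by (rule LeastI_ex)
  then have "foot u < length p \<and> (p ! foot u, u) \<in> parcs G ^^ level u"
    unfolding foot_def by (rule LeastI_ex)
  then show "foot u < length p" "(p ! foot u, u) \<in> parcs G ^^ level u" by auto
  show "level u \<le> k" using level_le[OF i(1,3)] i(2) by simp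
qed

lemma level_0: "u \<in> pverts G \<Longrightarrow> level u = 0 \<Longrightarrow> p ! foot u = u"
  using foot(2)[of u] by simp

lemma level_foot_nth:
  assumes "i < length p"
  shows "level (p ! i) = 0" "foot (p ! i) = i"
proof -
  show l: "level (p ! i) = 0" using level_le[OF assms, of "p ! i" 0] by simp
  show "foot (p ! i) = i"
    using level_0[OF p_nth[OF assms] l] foot(1)[OF p_nth[OF assms]] assms spine
    by (simp add: spine_def nth_eq_iff_index_eq)
qed

text \<open>The vertex before \<open>u\<close> on a shortest walk from its foot. Its foot cannot be
  larger, by the choice of least index, nor smaller, since the walk to it extends to
  \<open>u\<close>.\<close>

lemma parent:
  assumes u: "u \<in> pverts G" and l: "level u = Suc n"
  shows "\<exists>w\<in>pverts G. (w, u) \<in> parcs G \<and> level w = n \<and> foot w = foot u"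
proof -
  obtain w where w: "(p ! foot u, w) \<in> parcs G ^^ n" "(w, u) \<in> parcs G"
    using foot(2)[OF u] l by auto
  then have wV: "w \<in> pverts G" using arcs by auto
  have "(p ! foot w, u) \<in> parcs G ^^ Suc (level w)" using foot(2)[OF wV] w(2) by auto
  then have "Suc n \<le> Suc (level w)" using level_le[OF foot(1)[OF wV]] l by metis
  moreover have "level w \<le> n" by (rule level_le[OF foot(1)[OF u] w(1)])
  ultimately have lw: "level w = n" by simp
  have "foot w \<le> foot u" using foot_le[OF foot(1)[OF u]] w(1) lw by simp
  moreover have "foot u \<le> foot w"
    using foot_le[OF foot(1)[OF wV]] \<open>(p ! foot w, u) \<in> parcs G ^^ Suc (level w)\<close> lw l by simp
  ultimately show ?thesis using w(2) wV lw by auto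
qed

lemma finite_branch: "finite (branch i)"
  unfolding branch_def using fin by simp

lemma nth_in_branch: "i < length p \<Longrightarrow> p ! i \<in> branch i"
  unfolding branch_def using level_foot_nth p_nth by simp

lemma level_le_depth: "u \<in> pverts G \<Longrightarrow> level u \<le> depth (foot u)"
  unfolding depth_def using finite_branch by (intro Max_ge) (auto simp: branch_def)

lemma depth_le: "i < length p \<Longrightarrow> depth i \<le> k"
  unfolding depth_def using finite_branch nth_in_branch[of i] foot(3)
  by (subst Max_le_iff) (auto simp: branch_def)

lemma level_initial_segment:
  assumes "u \<in> branch i" "n \<le> level u"
  shows "n \<in> level ` branch i"
  using assms
proof (induction "level u" arbitrary: u)
  case (Suc l)
  then obtain w where "w \<in> pverts G" "level w = l" "foot w = i"
    using parent[of u l] by (auto simp: branch_def)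
  then show ?case using Suc by (cases "n = Suc l") (auto simp: branch_def)
qed auto

text \<open>Following parents from a deepest vertex meets every level from 0 to the depth. These
  vertices pay for obstructed radii.\<close>

lemma depth_less_card_branch:
  assumes "i < length p"
  shows "depth i < card (branch i)"
proof -
  have "depth i \<in> level ` branch i"
    unfolding depth_def using finite_branch nth_in_branch[OF assms] by (intro Max_in) auto
  then have "{0..depth i} \<subseteq> level ` branch i" using level_initial_segment by fastforce
  then have "card {0..depth i} \<le> card (level ` branch i)"
    by (rule card_mono[rotated]) (simp add: finite_branch)
  also have "\<dots> \<le> card (branch i)" by (rule card_image_le[OF finite_branch])
  finally show ?thesis by simp
qed

lemma spine_relpow:
  assumes "i \<le> j" "j < length p"
  shows "(p ! i, p ! j) \<in> parcs G ^^ (j - i)"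
  using assms
proof (induction j rule: dec_induct)
  case (step j)
  then have "(p ! j, p ! Suc j) \<in> parcs G" using spine by (simp add: spine_def)
  then show ?case using step by (auto simp: Suc_diff_le)
qed simp

lemma spine_ball:
  assumes "u \<in> pverts G" "c < length p" "\<bar>int (foot u) - int c\<bar> + int (depth (foot u)) \<le> int r"
  shows "\<exists>n\<le>r. (p ! c, u) \<in> parcs G ^^ n"
proof -
  define s where "s = nat \<bar>int (foot u) - int c\<bar>"
  have "(p ! c, p ! foot u) \<in> parcs G ^^ s"
  proof (cases "c \<le> foot u")
    case True
    then show ?thesis using spine_relpow[OF True foot(1)[OF assms(1)]] by (simp add: s_def nat_diff_distrib)
  next
    case False
    then show ?thesis using relpow_sym[OF sym spine_relpow[of "foot u" c]] assms(2)
      by (simp add: s_def nat_diff_distrib)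
  qed
  then have "(p ! c, u) \<in> parcs G ^^ (s + level u)"
    using foot(2)[OF assms(1)] by (auto simp: relpow_add)
  moreover have "s + level u \<le> r" using level_le_depth[OF assms(1)] assms(3) by (simp add: s_def)
  ultimately show ?thesis by blast
qed

section \<open>Cutting off an initial piece\<close>

definition tail_graph :: "nat \<Rightarrow> 'a pair_pre_digraph" where
  "tail_graph q = \<lparr>pverts = {u \<in> pverts G. q \<le> foot u},
     parcs = {(u, v) \<in> parcs G. q \<le> foot u \<and> q \<le> foot v}\<rparr>"

text \<open>Parents keep the foot, so the walk from the foot never leaves the tail.\<close>

lemma tail_graph_branch:
  assumes "u \<in> pverts (tail_graph q)"
  shows "(p ! foot u, u) \<in> parcs (tail_graph q) ^^ level u"
  using assms
proof (induction "level u" arbitrary: u)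
  case 0
  then show ?case using level_0[of u] by (simp add: tail_graph_def)
next
  case (Suc l)
  then obtain w where w: "w \<in> pverts G" "(w, u) \<in> parcs G" "level w = l" "foot w = foot u"
    using parent[of u l] by (auto simp: tail_graph_def)
  then have "(p ! foot u, w) \<in> parcs (tail_graph q) ^^ l"
    using Suc.hyps(1)[of w] Suc.prems by (simp add: tail_graph_def)
  moreover have "(w, u) \<in> parcs (tail_graph q)" using w Suc.prems by (simp add: tail_graph_def)
  ultimately show ?case unfolding Suc.hyps(2)[symmetric] by auto
qed

lemma pair_graph_tail: "pair_graph (tail_graph q)"
  using pg unfolding pair_graph_iff by (auto simp: tail_graph_def sym_def irrefl_def)

lemma spine_tail:
  assumes "q < length p"
  shows "spine (tail_graph q) k (drop q p)"
  unfolding spine_def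
proof (intro conjI allI impI ballI)
  show "set (drop q p) \<subseteq> pverts (tail_graph q)"
    using level_foot_nth p_nth by (auto simp: tail_graph_def in_set_conv_nth)
  show "(drop q p ! i, drop q p ! Suc i) \<in> parcs (tail_graph q)" if "Suc i < length (drop q p)" for i
    using that level_foot_nth spine by (simp add: tail_graph_def spine_def)
  fix v assume v: "v \<in> pverts (tail_graph q)"
  then have vV: "v \<in> pverts G" "q \<le> foot v" by (auto simp: tail_graph_def)
  then have "p ! foot v = drop q p ! (foot v - q)" "foot v - q < length (drop q p)"
    using foot(1)[of v] by auto
  then have "p ! foot v \<in> set (drop q p)" by (metis nth_mem)
  then show "\<exists>u\<in>set (drop q p). \<exists>n\<le>k. (u, v) \<in> parcs (tail_graph q) ^^ n"
    using tail_graph_branch[OF v] foot(3)[OF vV(1)] by blast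
qed (use assms spine in \<open>auto simp: spine_def\<close>)

lemma utree_tail:
  assumes "q < length p"
  shows "utree (tail_graph q)"
  unfolding utree_iff
proof (intro conjI ballI notI)
  let ?H = "tail_graph q"
  show "pair_graph ?H" by (rule pair_graph_tail)
  show False if "pverts ?H = {}"
    using that level_foot_nth[OF assms] p_nth[OF assms] by (auto simp: tail_graph_def)
  have sp: "spine ?H k (drop q p)" by (rule spine_tail[OF assms])
  have symH: "sym (parcs ?H)" using pair_graph_tail[of q] by (simp add: pair_graph_iff)
  have start: "(p ! q, p ! (q + i)) \<in> (parcs ?H)\<^sup>*" if "q + i < length p" for i
    using that
  proof (induction i)
    case (Suc i)
    then have "(p ! (q + i), p ! Suc (q + i)) \<in> parcs ?H"
      using sp[unfolded spine_def] by (auto dest: spec[of _ i])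
    then show ?case using Suc by auto
  qed simp
  have reach: "(p ! q, u) \<in> (parcs ?H)\<^sup>*" if u: "u \<in> pverts ?H" for u
  proof -
    have "q \<le> foot u" "foot u < length p" using u foot(1)[of u] by (auto simp: tail_graph_def)
    then have "(p ! q, p ! foot u) \<in> (parcs ?H)\<^sup>*" using start[of "foot u - q"] by simp
    then show ?thesis using tail_graph_branch[OF u] by (meson relpow_imp_rtrancl rtrancl_trans)
  qed
  show "(u, v) \<in> (parcs ?H)\<^sup>*" if "u \<in> pverts ?H" "v \<in> pverts ?H" for u v
    using reach that symD[OF sym_rtrancl[OF symH]] by (meson rtrancl_trans)
  show False if "\<exists>u c. long_cycle ?H u c"
  proof -
    from that obtain u c where "long_cycle ?H u c" by blast
    then have "long_cycle G (id u) (map (map_prod id id) c)"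
      by (rule long_cycle_map)
        (use pair_graph_tail[of q] in \<open>auto simp: pair_graph_iff tail_graph_def\<close>)
    then show False using tree by (simp add: utree_iff)
  qed
qed

lemma growth_tail: "q < length p \<Longrightarrow> growth (tail_graph q) \<le> k"
  by (rule growth_le[OF pair_graph_tail spine_tail])

lemma card_head: "card {u \<in> pverts G. foot u < q} = (\<Sum>i<q. card (branch i))"
proof -
  have "{u \<in> pverts G. foot u < q} = (\<Union>i<q. branch i)" by (auto simp: branch_def)
  also have "card \<dots> = (\<Sum>i<q. card (branch i))"
    by (rule card_UN_disjoint) (auto simp: finite_branch, auto simp: branch_def)
  finally show ?thesis .
qed

text \<open>Balls indexed 1 to j have the j largest radii; the rest of the tree is burned as if the
  process had started at step j + 1.\<close>

lemma burning_number_le_of_prefix: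
  assumes cov: "\<And>u. u \<in> pverts G \<Longrightarrow> foot u < q \<Longrightarrow>
      \<exists>r. m - j \<le> r \<and> r < m \<and> \<bar>int (foot u) - c (int r)\<bar> + int (depth (foot u)) \<le> int r"
    and j: "j \<le> m"
    and tail: "q < length p \<Longrightarrow> burning_number (tail_graph q) \<le> m - j"
  shows "burning_number G \<le> m"
proof -
  \<comment> \<open>Centres beyond the spine are moved to its nearest end, which brings them no
    farther from any spine position.\<close>
  define clamp where "clamp x = nat (max 0 (min x (int (length p) - 1)))" for x
  have len: "0 < length p" using spine by (auto simp: spine_def)
  have clamp: "clamp x < length p" for x using len unfolding clamp_def by linarith
  define b where "b = burning_number (tail_graph q)"
  obtain v where v: "burning_seq (tail_graph q) b v"
    using burning_number_seq[OF pair_graph_tail] unfolding b_def by blast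
  \<comment> \<open>Step \<open>i\<close> has radius \<open>m - i\<close>. Steps left over after the
    tail has burned get the arbitrary vertex \<open>p ! 0\<close>.\<close>
  define f where "f i = (if i \<le> j then p ! clamp (c (int (m - i)))
    else if i - j \<le> b then v (i - j) else p ! 0)" for i
  have "burning_seq G m f"
    unfolding burning_seq_def
  proof (intro conjI ballI)
    fix i assume i: "i \<in> {1..m}"
    have "v (i - j) \<in> pverts G" if "j < i" "i - j \<le> b"
      using v that by (auto simp: burning_seq_def tail_graph_def)
    then show "f i \<in> pverts G" using len clamp p_nth by (simp add: f_def)
  next
    fix u assume u: "u \<in> pverts G"
    show "\<exists>i\<in>{1..m}. \<exists>n\<le>m - i. (f i, u) \<in> parcs G ^^ n"
    proof (cases "foot u < q")
      case True
      then obtain r where r: "m - j \<le> r" "r < m"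
          and near: "\<bar>int (foot u) - c (int r)\<bar> + int (depth (foot u)) \<le> int r"
        using cov[OF u] by blast
      have "\<bar>int (foot u) - int (clamp (c (int r)))\<bar> \<le> \<bar>int (foot u) - c (int r)\<bar>"
        unfolding clamp_def using foot(1)[OF u] by linarith
      then have "\<exists>n\<le>r. (p ! clamp (c (int r)), u) \<in> parcs G ^^ n"
        using near by (intro spine_ball[OF u clamp]) linarith
      moreover have "f (m - r) = p ! clamp (c (int r))" using r j unfolding f_def by auto
      ultimately show ?thesis using r by (intro bexI[of _ "m - r"]) auto
    next
      case False
      then have "u \<in> pverts (tail_graph q)" using u by (simp add: tail_graph_def)
      then obtain i n where i: "i \<in> {1..b}" "n \<le> b - i" "(v i, u) \<in> parcs (tail_graph q) ^^ n"
        using v unfolding burning_seq_def by blast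
      have "b \<le> m - j" unfolding b_def using tail False foot(1)[OF u] by simp
      moreover have "(v i, u) \<in> parcs G ^^ n"
        using relpow_map[OF i(3), of id "parcs G"] by (simp add: tail_graph_def)
      moreover have "f (i + j) = v i" using i by (simp add: f_def)
      ultimately show ?thesis using i j by (intro bexI[of _ "i + j"] exI[of _ n]) auto
    qed
  qed
  then show ?thesis by (rule burning_number_le[OF pg])
qed

text \<open>The piece cut off has at least \<open>m^2 - (m - j)^2\<close> vertices, so the tail
  falls under the induction hypothesis with \<open>m - j\<close>.\<close>

lemma descent:
  assumes card_le: "card (pverts G) \<le> m\<^sup>2" and m: "4 * k\<^sup>2 + 5 * k + 5 \<le> m"
    and smaller: "\<And>(H :: 'a pair_pre_digraph) b. utree H \<Longrightarrow> growth H \<le> k \<Longrightarrow>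
      card (pverts H) < card (pverts G) \<Longrightarrow> card (pverts H) \<le> b\<^sup>2 \<Longrightarrow> burning_number H \<le> b"
  shows "burning_number G \<le> m"
proof -
  define L where "L = int (length p)"
  define d where "d i = (if 0 \<le> i \<and> i < L then int (depth (nat i)) else 0)" for i
  define lam where "lam = Max (insert 0 ((\<lambda>i. d i - i) ` {0..<L}))"
  have d_le: "d i \<le> int k" for i using depth_le by (auto simp: d_def L_def)
  have d_nonneg: "0 \<le> d i" for i by (simp add: d_def)
  have lam_in: "lam \<in> insert 0 ((\<lambda>i. d i - i) ` {0..<L})"
    unfolding lam_def by (rule Max_in) auto
  have lam_ge: "x \<le> lam" if "x \<in> insert 0 ((\<lambda>i. d i - i) ` {0..<L})" for x
    unfolding lam_def by (rule Max_ge) (use that in auto)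
  have "int (4 * k\<^sup>2 + 5 * k + 5) \<le> int m" using m by (rule of_nat_mono)
  then interpret line: spine_burning d "int k" "int m" lam
  proof unfold_locales
    show "0 \<le> lam" using lam_ge[of 0] by simp
    show "lam \<le> int k" using lam_in
    proof
      assume "lam \<in> (\<lambda>i. d i - i) ` {0..<L}"
      then obtain i where "0 \<le> i" "lam = d i - i" by auto
      then show ?thesis using d_le[of i] by simp
    qed simp
    show "- lam \<le> i - d i" if "0 \<le> i" for i
    proof (cases "i < L")
      case True
      then show ?thesis using lam_ge[of "d i - i"] that by simp
    next
      case False
      then show ?thesis using lam_ge[of 0] that by (simp add: d_def)
    qed
  qed (use d_le d_nonneg in auto)
  obtain j' q' c where j': "1 \<le> j'" "j' \<le> line.J" and q': "int k \<le> q'"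
      and covers: "line.covers {int m - j'..<int m} q' c"
      and big: "line.lengths {int m - j'..<int m} \<le> q' + lam + line.depth_sum q'"
    using line.solved_holds unfolding line.solved_def by blast
  define j where "j = nat j'"
  define q where "q = nat q'"
  have j: "1 \<le> j" "j \<le> m" "int j = j'" using j' line.J_bounds by (auto simp: j_def)
  have q: "int q = q'" using q' by (simp add: q_def)
  show ?thesis
  proof (rule burning_number_le_of_prefix[OF _ j(2)])
    fix u assume u: "u \<in> pverts G" "foot u < q"
    then obtain r where "int m - j' \<le> r" "r < int m"
        "\<bar>int (foot u) - c r\<bar> + d (int (foot u)) \<le> r"
      using covers[unfolded line.covers_def, rule_format, of "int (foot u)"] q by auto
    moreover have "d (int (foot u)) = int (depth (foot u))"
      using foot(1)[OF u(1)] by (simp add: d_def L_def)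
    ultimately show "\<exists>r. m - j \<le> r \<and> r < m \<and>
        \<bar>int (foot u) - c (int r)\<bar> + int (depth (foot u)) \<le> int r"
      using j by (intro exI[of _ "nat r"]) auto
  next
    assume qL: "q < length p"
    have weight: "1 + d (int i) \<le> int (card (branch i))" if "i < q" for i
      using depth_less_card_branch[of i] that qL by (simp add: d_def L_def)
    have range: "{0..<int q} = int ` {..<q}"
      by (auto simp: image_iff intro!: bexI[of _ "nat _"])
    have "(\<Sum>i\<in>{0..<int q}. d i) = (\<Sum>i<q. d (int i))"
      unfolding range by (simp add: sum.reindex)
    then have "int q + (\<Sum>i\<in>{0..<int q}. d i) = (\<Sum>i<q. 1 + d (int i))"
      by (simp add: sum.distrib)
    also have "\<dots> \<le> (\<Sum>i<q. int (card (branch i)))" by (rule sum_mono) (use weight in auto)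
    finally have "int q + (\<Sum>i\<in>{0..<int q}. d i) \<le> int (card {u \<in> pverts G. foot u < q})"
      unfolding card_head by simp
    moreover have "(\<Sum>i\<in>{0..<int q}. d i) = (\<Sum>i\<in>{0..<int k}. d i) + line.depth_sum q'"
    proof -
      have "{0..<int q} = {0..<int k} \<union> {int k..<q'}" using q q' by auto
      then show ?thesis unfolding line.depth_sum_def by (simp add: sum.union_disjoint)
    qed
    \<comment> \<open>A positive \<open>lam\<close> equals \<open>d i - i\<close> for some
      \<open>i\<close> below \<open>k\<close>, so a single term of the sum pays for it.\<close>
    moreover have "lam \<le> (\<Sum>i\<in>{0..<int k}. d i)"
      using lam_in
    proof
      assume "lam \<in> (\<lambda>i. d i - i) ` {0..<L}"
      then obtain i where i: "0 \<le> i" "lam = d i - i" by auto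
      show ?thesis
      proof (cases "i < int k")
        case True
        then have "d i \<le> (\<Sum>i\<in>{0..<int k}. d i)"
          using i d_nonneg by (intro member_le_sum) auto
        then show ?thesis using i by simp
      next
        case False
        then have "lam \<le> 0" using i d_le[of i] by simp
        also have "0 \<le> (\<Sum>i\<in>{0..<int k}. d i)" using d_nonneg by (simp add: sum_nonneg)
        finally show ?thesis .
      qed
    qed (use d_nonneg in \<open>simp add: sum_nonneg\<close>)
    ultimately have removed: "line.lengths {int m - j'..<int m} \<le> int (card {u \<in> pverts G. foot u < q})"
      using big q by linarith
    have "{int m - j'..<int m} = {int (m - j)..<int (m - j) + int j}" using j by auto
    then have lengths: "line.lengths {int m - j'..<int m} = (int m)\<^sup>2 - (int (m - j))\<^sup>2"
      unfolding line.lengths_def using sum_odd_int[of "m - j" j] j by (simp add: of_nat_diff)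
    have split: "card (pverts G) = card {u \<in> pverts G. foot u < q} + card (pverts (tail_graph q))"
    proof -
      have "pverts G = {u \<in> pverts G. foot u < q} \<union> pverts (tail_graph q)"
        by (auto simp: tail_graph_def)
      then show ?thesis
        using fin by (subst card_Un_disjoint[symmetric]) (auto simp: tail_graph_def)
    qed
    have "(int (m - j))\<^sup>2 < (int m)\<^sup>2" using j by (intro power_strict_mono) auto
    then have "card (pverts (tail_graph q)) < card (pverts G)"
      using removed lengths split by linarith
    moreover have "int (card (pverts G)) \<le> (int m)\<^sup>2"
      using card_le by (metis of_nat_mono of_nat_power)
    then have "int (card (pverts (tail_graph q))) \<le> (int (m - j))\<^sup>2"
      using removed lengths split by linarith
    then have "card (pverts (tail_graph q)) \<le> (m - j)\<^sup>2"
      by (metis of_nat_le_iff of_nat_power)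
    ultimately show "burning_number (tail_graph q) \<le> m - j"
      by (intro smaller[OF utree_tail[OF qL] growth_tail[OF qL]])
  qed
qed

end

section \<open>Rounded square roots and the induction\<close>

lemma ceiling_sqrt_le_iff:
  "\<lceil>sqrt (real n)\<rceil> \<le> int b \<longleftrightarrow> n \<le> b\<^sup>2"
proof -
  have "\<lceil>sqrt (real n)\<rceil> \<le> int b \<longleftrightarrow> sqrt (real n) \<le> real b" by (simp add: ceiling_le_iff)
  also have "\<dots> \<longleftrightarrow> real n \<le> (real b)\<^sup>2"
    using real_sqrt_le_iff[of "real n" "(real b)\<^sup>2"] by simp
  also have "\<dots> \<longleftrightarrow> n \<le> b\<^sup>2" by (metis of_nat_le_iff of_nat_power)
  finally show ?thesis .
qed

text \<open>The rounded root of \<open>n\<close> is the least \<open>m\<close> with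
  \<open>n <= m^2\<close>.\<close>

lemma le_ceiling_sqrt_iff:
  "int b \<le> \<lceil>sqrt (real n)\<rceil> \<longleftrightarrow> (\<forall>m. n \<le> m\<^sup>2 \<longrightarrow> b \<le> m)"
proof
  assume "\<forall>m. n \<le> m\<^sup>2 \<longrightarrow> b \<le> m"
  moreover have "0 \<le> sqrt (real n)" by simp
  then have "0 \<le> \<lceil>sqrt (real n)\<rceil>" by linarith
  then have "n \<le> (nat \<lceil>sqrt (real n)\<rceil>)\<^sup>2" unfolding ceiling_sqrt_le_iff[symmetric] by simp
  ultimately have "b \<le> nat \<lceil>sqrt (real n)\<rceil>" by blast
  then show "int b \<le> \<lceil>sqrt (real n)\<rceil>" using \<open>0 \<le> \<lceil>sqrt (real n)\<rceil>\<close> by linarith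
next
  assume "int b \<le> \<lceil>sqrt (real n)\<rceil>"
  then show "\<forall>m. n \<le> m\<^sup>2 \<longrightarrow> b \<le> m" unfolding ceiling_sqrt_le_iff[symmetric] by force
qed

theorem theorem2p7:
  fixes k :: nat
  shows "(\<forall>T :: 'a pair_pre_digraph. utree T \<and> growth T \<le> k \<longrightarrow>
            int (burning_number T) \<le> \<lceil>sqrt (real (card (pverts T)))\<rceil>) \<or>
         (\<exists>T :: nat pair_pre_digraph. utree T \<and> growth T \<le> k \<and>
            card (pverts T) \<le> (4 * k\<^sup>2 + 5 * k + 4)\<^sup>2 \<and>
            int (burning_number T) > \<lceil>sqrt (real (card (pverts T)))\<rceil>)"
proof (rule disjCI)
  assume no_small: "\<not> (\<exists>T :: nat pair_pre_digraph. utree T \<and> growth T \<le> k \<and>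
            card (pverts T) \<le> (4 * k\<^sup>2 + 5 * k + 4)\<^sup>2 \<and>
            int (burning_number T) > \<lceil>sqrt (real (card (pverts T)))\<rceil>)"
  \<comment> \<open>Any \<open>b\<close> with enough room is allowed, since a tail is only known to
    fit into \<open>(m - j)^2\<close>.\<close>
  have burns: "burning_number T \<le> b"
    if "utree T" "growth T \<le> k" "card (pverts T) \<le> b\<^sup>2" for T :: "'a pair_pre_digraph" and b
    using that
  proof (induction "card (pverts T)" arbitrary: T b rule: less_induct)
    case less
    show ?case
    proof (cases "card (pverts T) \<le> (4 * k\<^sup>2 + 5 * k + 4)\<^sup>2")
      case True
      obtain H :: "nat pair_pre_digraph" where "utree H" "growth H \<le> k"
          "card (pverts H) = card (pverts T)" "burning_number T \<le> burning_number H"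
        using utree_nat_copy[OF less.prems(1,2)] by blast
      moreover from this have "int (burning_number H) \<le> \<lceil>sqrt (real (card (pverts H)))\<rceil>"
        using no_small True by force
      ultimately show ?thesis using less.prems(3) unfolding le_ceiling_sqrt_iff by force
    next
      case False
      then have "(4 * k\<^sup>2 + 5 * k + 4)\<^sup>2 < b\<^sup>2" using less.prems(3) by linarith
      then have b: "4 * k\<^sup>2 + 5 * k + 5 \<le> b" using power2_less_imp_less by fastforce
      obtain p where "spine T k p" using growth_spine less.prems by blast
      then interpret spined_graph T k p using less.prems(1) by unfold_locales
      show ?thesis by (rule descent[OF less.prems(3) b]) (use less.hyps in blast)
    qed
  qed
  show "\<forall>T :: 'a pair_pre_digraph. utree T \<and> growth T \<le> k \<longrightarrow>
            int (burning_number T) \<le> \<lceil>sqrt (real (card (pverts T)))\<rceil>"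
    unfolding le_ceiling_sqrt_iff using burns by blast
qed

end
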